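(* Let $A_1,\dots,A_\ell\in\mathbb R^{n\times n}$ be the state matrices of a linear switched system $\dot{\boldsymbol x}(t)=A_\sigma\boldsymbol x(t)+B_\sigma\boldsymbol u(t)$, $\boldsymbol y(t)=C_\sigma\boldsymbol x(t)+D_\sigma\boldsymbol u(t)$ with modes $(A_i,B_i,C_i,D_i)$, $i=1,\dots,\ell$. The switched system is quadratic Lyapunov stable if and only if there exist a matrix $Q\in\mathbb R^{n\times n}$ with $Q=Q^T>0$ and matrices $J_i,R_i\in\mathbb R^{n\times n}$ with $J_i^T=-J_i$ and $R_i=R_i^T>0$ such that $A_i=(J_i-R_i)Q$ for $i=1,\dots,\ell$.
   Context: For a symmetric real matrix $X$, $X>0$ means positive definite and $X<0$ means negative definite. A linear switched system with state matrices $A_1,\dots,A_\ell\in\mathbb R^{n\times n}$ is called quadratic Lyapunov stable if there exists a symmetric positive definite matrix $Q\in\mathbb R^{n\times n}$ such that $A_i^TQ+QA_i<0$ for all $i\in\{1,\dots,\ell\}$. *)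

theory Defs
  imports "HOL-Analysis.Analysis"
begin

definition positive_definite :: "real ^ 'n ^ 'n \<Rightarrow> bool" where
  "positive_definite X \<longleftrightarrow> transpose X = X \<and> (\<forall>v. v \<noteq> 0 \<longrightarrow> v \<bullet> (X *v v) > 0)"

definition negative_definite :: "real ^ 'n ^ 'n \<Rightarrow> bool" where
  "negative_definite X \<longleftrightarrow> transpose X = X \<and> (\<forall>v. v \<noteq> 0 \<longrightarrow> v \<bullet> (X *v v) < 0)"

(* The data (A, B, C, D) of one mode x' = A x + B u, y = C x + D u, with state space real ^ 'n,
   input space real ^ 'm and output space real ^ 'p. *)
record ('n, 'm, 'p) mode =
  state_mat :: "real ^ 'n ^ 'n"
  input_mat :: "real ^ 'm ^ 'n"
  output_mat :: "real ^ 'n ^ 'p"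
  feedthrough_mat :: "real ^ 'm ^ 'p"

(* A linear switched system with l modes is given by its modes S 1, ..., S l;
   values of S outside {1..l} are irrelevant. *)
definition quadratic_lyapunov_stable ::
  "nat \<Rightarrow> (nat \<Rightarrow> ('n::finite, 'm::finite, 'p::finite) mode) \<Rightarrow> bool" where
  "quadratic_lyapunov_stable l S \<longleftrightarrow>
     (\<exists>Q. positive_definite Q \<and>
          (\<forall>i\<in>{1..l}. negative_definite
             (transpose (state_mat (S i)) ** Q + Q ** state_mat (S i))))"

end

(* The same Q serves both directions. The Lyapunov form is
   v . (A^T Q + Q A) v = 2 (Q v) . (A v); with M = A Q^-1 and w = Q v this is 2 w . M w, which sees
   only the symmetric part of M. So the Lyapunov inequality says that -R, the symmetric part of M,
   is negative definite, and J is the skew part. *)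
theory Submission
  imports Defs
begin

lemma transpose_add: "transpose (A + B) = transpose A + transpose B"
  for A B :: "'a::ab_group_add ^ 'n ^ 'm"
  by (simp add: transpose_def vec_eq_iff)

lemma inner_transpose_mult: "v \<bullet> (transpose A *v w) = (A *v v) \<bullet> w"
  for A :: "real ^ 'n ^ 'm"
  using dot_lmul_matrix[of w A v] by (simp add: inner_commute)

text \<open>A nonzero kernel vector \<open>v\<close> would give
  \<open>v \<bullet> (Q *v v) = 0\<close>, and a square matrix with trivial kernel is
  invertible.\<close>

lemma invertible_positive_definite:
  fixes Q :: "real ^ 'n ^ 'n"
  assumes "positive_definite Q"
  shows "invertible Q"
proof -
  have "v = 0" if "Q *v v = 0" for v
    using assms that by (force simp: positive_definite_def)
  then show ?thesis
    by (simp add: invertible_left_inverse matrix_left_invertible_ker)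
qed

text \<open>Symmetry of \<open>Q\<close> lets it move across the inner product, so both summands
  contribute the same number.\<close>

lemma inner_lyapunov:
  fixes A Q :: "real ^ 'n ^ 'n"
  assumes "transpose Q = Q"
  shows "v \<bullet> ((transpose A ** Q + Q ** A) *v v) = 2 * ((Q *v v) \<bullet> (A *v v))"
proof -
  have "v \<bullet> (Q *v (A *v v)) = (Q *v v) \<bullet> (A *v v)"
    using inner_transpose_mult[of v Q "A *v v"] assms by simp
  then show ?thesis
    by (simp add: matrix_vector_mult_add_rdistrib inner_add_right inner_transpose_mult inner_commute
        del: transpose_matrix_vector flip: matrix_vector_mul_assoc)
qed

text \<open>Moving \<open>J\<close> across the inner product flips the sign, so this number equals
  its own negative.\<close>

lemma inner_skew:
  fixes J :: "real ^ 'n ^ 'n"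
  assumes "transpose J = - J"
  shows "w \<bullet> (J *v w) = 0"
proof -
  have "(J *v w) \<bullet> w = w \<bullet> ((- J) *v w)"
    using inner_transpose_mult[of w J w] assms by simp
  also have "(- J) *v w = - (J *v w)"
    using matrix_vector_mult_diff_rdistrib[of 0 J w] by simp
  finally show ?thesis
    by (simp add: inner_commute)
qed

text \<open>The case of a single mode with \<open>Q\<close> held fixed. Modes interact only through
  the common \<open>Q\<close>, so this carries the whole theorem.\<close>

lemma negative_definite_lyapunov_iff:
  fixes A Q :: "real ^ 'n ^ 'n"
  assumes Q: "positive_definite Q"
  shows "negative_definite (transpose A ** Q + Q ** A) \<longleftrightarrow>
    (\<exists>J R. transpose J = - J \<and> R = transpose R \<and> positive_definite R \<and> A = (J - R) ** Q)"
    (is "?lyap \<longleftrightarrow> ?decomp")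
proof -
  have sym: "transpose Q = Q"
    using Q by (simp add: positive_definite_def)
  show ?thesis
  proof
    assume ?lyap
    obtain P where PQ: "P ** Q = mat 1" and QP: "Q ** P = mat 1"
      using invertible_positive_definite[OF Q] by (auto simp: invertible_def)
    \<comment> \<open>The required factorization forces \<open>J - R = A ** P\<close>, so the skew
      part and the negated symmetric part are the only candidates.\<close>
    define M where "M = A ** P"
    define J where "J = (1/2) *\<^sub>R (M - transpose M)"
    define R where "R = - ((1/2) *\<^sub>R (M + transpose M))"
    have J: "transpose J = - J"
      by (simp add: J_def transpose_def vec_eq_iff field_simps)
    have R: "transpose R = R"
      by (simp add: R_def transpose_def vec_eq_iff add.commute)
    have JR: "J - R = M"
      by (simp add: J_def R_def vec_eq_iff field_simps)
    have A: "A = (J - R) ** Q"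
      by (simp add: JR M_def PQ flip: matrix_mul_assoc)
    have "w \<bullet> (R *v w) > 0" if "w \<noteq> 0" for w
    proof -
      \<comment> \<open>The Lyapunov inequality reaches every nonzero \<open>w\<close>, because
        \<open>Q\<close> is onto.\<close>
      define v where "v = P *v w"
      have w: "w = Q *v v"
        by (simp add: v_def matrix_vector_mul_assoc QP)
      with that have "v \<noteq> 0"
        by auto
      with \<open>?lyap\<close> have "(Q *v v) \<bullet> (A *v v) < 0"
        by (auto simp: negative_definite_def inner_lyapunov[OF sym])
      then have "w \<bullet> ((J - R) *v w) < 0"
        by (simp add: A w flip: matrix_vector_mul_assoc)
      then show ?thesis
        by (simp add: matrix_vector_mult_diff_rdistrib inner_diff_right inner_skew[OF J])
    qed
    then have "positive_definite R"
      using R by (simp add: positive_definite_def)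
    with J R A show ?decomp
      by metis
  next
    assume ?decomp
    then obtain J R where J: "transpose J = - J" and R: "positive_definite R"
      and A: "A = (J - R) ** Q"
      by blast
    have "v \<bullet> ((transpose A ** Q + Q ** A) *v v) < 0" if "v \<noteq> 0" for v
    proof -
      \<comment> \<open>Injectivity of \<open>Q\<close> keeps the vector on which \<open>R\<close>
        is tested nonzero, so the inequality stays strict.\<close>
      have "Q *v v \<noteq> 0"
        using Q that by (force simp: positive_definite_def)
      with R have "(Q *v v) \<bullet> (R *v (Q *v v)) > 0"
        by (simp add: positive_definite_def)
      then have "(Q *v v) \<bullet> (A *v v) < 0"
        by (simp add: A matrix_vector_mult_diff_rdistrib inner_diff_right inner_skew[OF J]
            flip: matrix_vector_mul_assoc)
      then show ?thesis
        by (simp add: inner_lyapunov[OF sym])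
    qed
    \<comment> \<open>What remains is symmetry: transposition swaps the two summands.\<close>
    then show ?lyap
      by (simp add: negative_definite_def transpose_add matrix_transpose_mul sym add.commute)
  qed
qed

theorem proposition4p1:
  fixes l :: nat
    and S :: "nat \<Rightarrow> ('n::finite, 'm::finite, 'p::finite) mode"
  shows "quadratic_lyapunov_stable l S \<longleftrightarrow>
    (\<exists>(Q :: real ^ 'n ^ 'n) (J :: nat \<Rightarrow> real ^ 'n ^ 'n) (R :: nat \<Rightarrow> real ^ 'n ^ 'n).
       Q = transpose Q \<and> positive_definite Q \<and>
       (\<forall>i\<in>{1..l}. transpose (J i) = - J i \<and>
          R i = transpose (R i) \<and> positive_definite (R i) \<and>
          state_mat (S i) = (J i - R i) ** Q))"
    (is "_ \<longleftrightarrow> (\<exists>Q J R. ?decomp Q J R)")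
proof -
  have "positive_definite Q \<and>
      (\<forall>i\<in>{1..l}. negative_definite (transpose (state_mat (S i)) ** Q + Q ** state_mat (S i)))
      \<longleftrightarrow> (\<exists>J R. ?decomp Q J R)" for Q
  proof (cases "positive_definite Q")
    case True
    then have sym: "transpose Q = Q"
      by (simp add: positive_definite_def)
    show ?thesis
      \<comment> \<open>Choice over \<open>{1..l}\<close> gathers the matrices found for each mode
        into the functions \<open>J\<close> and \<open>R\<close>.\<close>
      by (simp only: True sym negative_definite_lyapunov_iff[OF True] bchoice_iff simp_thms)
  qed simp
  then show ?thesis
    by (simp only: quadratic_lyapunov_stable_def)
qed

end
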